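(* Let $G=(V_G,E_G)$ be a finite connected multigraph without self-loops containing at least one edge. Let $\eta^*$ be the optimal density for $\mathrm{Mod}_2(\widehat{\Gamma_G})$. Let $H_{\min}\subset E_G$ be the edge-induced subgraph consisting of the edges where $\eta^*$ attains its minimum, and let $H$ be a connected component of $H_{\min}$. Then: 1. $H$ has at least one edge. 2. $H$ has the restriction property. 3. $H$ is a vertex-induced subgraph of $G$. 4. $H$ is itself a homogeneous graph.
   Context: For a finite connected multigraph $G=(V,E)$, $\Gamma_G$ is the set of spanning trees of $G$ (as subsets of $E$), $\mathcal{P}(\Gamma_G)$ the set of probability mass functions (pmfs) on it. A pmf is optimal for MEO if it minimizes $\sum_{\gamma,\gamma'\in\Gamma_G}|\gamma\cap\gamma'|\,\mu(\gamma)\mu(\gamma')$ over $\mathcal{P}(\Gamma_G)$. A spanning tree $\gamma$ is fair if $\mu^*(\gamma)>0$ for some optimal $\mu^*$. $\mathrm{Adm}(\Gamma_G)=\{\rho\in\mathbb{R}^E_{\ge0}:\sum_{e\in\gamma}\rho(e)\ge1\ \forall\gamma\in\Gamma_G\}$; the Fulkerson dual family $\widehat{\Gamma_G}$ is the set of extreme points of $\mathrm{Adm}(\Gamma_G)$; $\mathrm{Adm}(\widehat{\Gamma_G})=\{\eta\in\mathbb{R}^E_{\ge0}:\sum_{e\in E}\hat\gamma(e)\eta(e)\ge1\ \forall\hat\gamma\in\widehat{\Gamma_G}\}$; $\mathrm{Mod}_2(\widehat{\Gamma_G})=\min_{\eta\in\mathrm{Adm}(\widehat{\Gamma_G})}\sum_{e\in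 E}\eta(e)^2$, and the optimal (extremal) density $\eta^*$ is the unique minimizer. It is known that $\eta^*(e)=\sum_{\gamma\ni e}\mu^*(\gamma)$ for every optimal pmf $\mu^*$. A graph is homogeneous if its density $\eta^*$ is constant. Edge-induced subgraphs are identified with subsets of the edge set. A subgraph $H\subset E_G$ has the restriction property if $\gamma\cap H$ is a spanning tree of $H$ for every fair tree $\gamma$ of $G$. A subgraph with vertex set $V_H$ is vertex-induced if it contains every edge of $G$ with both endpoints in $V_H$. *)

theory Defs
  imports "HOL-Analysis.Analysis" "HOL-Probability.Probability_Mass_Function"
begin

section \<open>Multigraphs\<close>

text \<open>Undirected multigraphs: an edge is a label, and distinct edges may have the same set of
  end vertices. A self-loop is an edge whose set of end vertices is a singleton.\<close>

record ('v, 'e) multigraph =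
  verts :: "'v set"
  edges :: "'e set"
  ends :: "'e \<Rightarrow> 'v set"

definition finite_multigraph :: "('v, 'e) multigraph \<Rightarrow> bool" where
  "finite_multigraph G \<longleftrightarrow> finite (verts G) \<and> finite (edges G) \<and>
     (\<forall>e\<in>edges G. ends G e \<subseteq> verts G \<and> (card (ends G e) = 1 \<or> card (ends G e) = 2))"

definition loopless :: "('v, 'e) multigraph \<Rightarrow> bool" where
  "loopless G \<longleftrightarrow> (\<forall>e\<in>edges G. card (ends G e) \<noteq> 1)"

definition adjacent :: "('v, 'e) multigraph \<Rightarrow> 'v \<Rightarrow> 'v \<Rightarrow> bool" where
  "adjacent G u v \<longleftrightarrow> (\<exists>e\<in>edges G. ends G e = {u, v})"

definition reachable :: "('v, 'e) multigraph \<Rightarrow> 'v \<Rightarrow> 'v \<Rightarrow> bool" where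
  "reachable G = (adjacent G)\<^sup>*\<^sup>*"

definition graph_connected :: "('v, 'e) multigraph \<Rightarrow> bool" where
  "graph_connected G \<longleftrightarrow> verts G \<noteq> {} \<and> (\<forall>u\<in>verts G. \<forall>v\<in>verts G. reachable G u v)"

text \<open>A cycle of length \<open>k\<close> passes through \<open>k\<close> distinct vertices along \<open>k\<close> distinct edges;
  \<open>k = 1\<close> is a self-loop and \<open>k = 2\<close> a pair of parallel edges.\<close>

definition is_cycle :: "('v, 'e) multigraph \<Rightarrow> 'v list \<Rightarrow> 'e list \<Rightarrow> bool" where
  "is_cycle G vs es \<longleftrightarrow>
     es \<noteq> [] \<and> length vs = length es \<and> distinct vs \<and> distinct es \<and>
     set vs \<subseteq> verts G \<and> set es \<subseteq> edges G \<and>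
     (\<forall>i<length es. ends G (es ! i) = {vs ! i, vs ! (Suc i mod length vs)})"

definition is_tree :: "('v, 'e) multigraph \<Rightarrow> bool" where
  "is_tree G \<longleftrightarrow> graph_connected G \<and> (\<nexists>vs es. is_cycle G vs es)"

definition spanning_trees :: "('v, 'e) multigraph \<Rightarrow> 'e set set" where
  "spanning_trees G = {\<gamma>. \<gamma> \<subseteq> edges G \<and> is_tree (G\<lparr>edges := \<gamma>\<rparr>)}"

definition edge_induced :: "('v, 'e) multigraph \<Rightarrow> 'e set \<Rightarrow> ('v, 'e) multigraph" where
  "edge_induced G F = G\<lparr>verts := (\<Union>e\<in>F. ends G e), edges := F\<rparr>"

definition graph_components :: "('v, 'e) multigraph \<Rightarrow> ('v, 'e) multigraph set" where
  "graph_components G =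
     {G\<lparr>verts := C, edges := {e \<in> edges G. ends G e \<subseteq> C}\<rparr> | C.
        \<exists>v\<in>verts G. C = {w \<in> verts G. reachable G v w}}"

definition is_subgraph :: "('v, 'e) multigraph \<Rightarrow> ('v, 'e) multigraph \<Rightarrow> bool" where
  "is_subgraph H G \<longleftrightarrow>
     verts H \<subseteq> verts G \<and> edges H \<subseteq> edges G \<and> (\<forall>e\<in>edges H. ends H e = ends G e)"

definition vertex_induced :: "('v, 'e) multigraph \<Rightarrow> ('v, 'e) multigraph \<Rightarrow> bool" where
  "vertex_induced G H \<longleftrightarrow>
     is_subgraph H G \<and> (\<forall>e\<in>edges G. ends G e \<subseteq> verts H \<longrightarrow> e \<in> edges H)"

section \<open>Minimum expected overlap\<close>

definition tree_pmfs :: "('v, 'e) multigraph \<Rightarrow> 'e set pmf set" where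
  "tree_pmfs G = {\<mu>. set_pmf \<mu> \<subseteq> spanning_trees G}"

definition expected_overlap :: "('v, 'e) multigraph \<Rightarrow> 'e set pmf \<Rightarrow> real" where
  "expected_overlap G \<mu> =
     (\<Sum>\<gamma>\<in>spanning_trees G. \<Sum>\<gamma>'\<in>spanning_trees G.
        real (card (\<gamma> \<inter> \<gamma>')) * pmf \<mu> \<gamma> * pmf \<mu> \<gamma>')"

definition meo_optimal :: "('v, 'e) multigraph \<Rightarrow> 'e set pmf \<Rightarrow> bool" where
  "meo_optimal G \<mu> \<longleftrightarrow> is_arg_min (expected_overlap G) (\<lambda>\<nu>. \<nu> \<in> tree_pmfs G) \<mu>"

definition fair_tree :: "('v, 'e) multigraph \<Rightarrow> 'e set \<Rightarrow> bool" where
  "fair_tree G \<gamma> \<longleftrightarrow> \<gamma> \<in> spanning_trees G \<and> (\<exists>\<mu>. meo_optimal G \<mu> \<and> 0 < pmf \<mu> \<gamma>)"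

definition restriction_property :: "('v, 'e) multigraph \<Rightarrow> ('v, 'e) multigraph \<Rightarrow> bool" where
  "restriction_property G H \<longleftrightarrow>
     is_subgraph H G \<and> (\<forall>\<gamma>. fair_tree G \<gamma> \<longrightarrow> \<gamma> \<inter> edges H \<in> spanning_trees H)"

section \<open>Modulus of the Fulkerson dual family\<close>

text \<open>Edge labels are drawn from a finite type \<open>'e\<close>, and the space of real vectors indexed by the
  edges of \<open>G\<close> is the coordinate subspace of \<open>real ^ 'e\<close> of vectors vanishing off \<open>edges G\<close>.
  In this way a graph and its subgraphs share one ambient space.\<close>

definition nonneg_vectors :: "'e set \<Rightarrow> (real ^ 'e::finite) set" where
  "nonneg_vectors E = {\<rho>. (\<forall>e\<in>E. 0 \<le> \<rho> $ e) \<and> (\<forall>e. e \<notin> E \<longrightarrow> \<rho> $ e = 0)}"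

definition Adm :: "('v, 'e::finite) multigraph \<Rightarrow> (real ^ 'e) set" where
  "Adm G = {\<rho> \<in> nonneg_vectors (edges G). \<forall>\<gamma>\<in>spanning_trees G. 1 \<le> (\<Sum>e\<in>\<gamma>. \<rho> $ e)}"

definition fulkerson_dual :: "('v, 'e::finite) multigraph \<Rightarrow> (real ^ 'e) set" where
  "fulkerson_dual G = {\<rho>. \<rho> extreme_point_of Adm G}"

definition Adm_dual :: "('v, 'e::finite) multigraph \<Rightarrow> (real ^ 'e) set" where
  "Adm_dual G = {\<eta> \<in> nonneg_vectors (edges G).
     \<forall>\<rho>\<in>fulkerson_dual G. 1 \<le> (\<Sum>e\<in>edges G. \<rho> $ e * \<eta> $ e)}"

definition energy2 :: "('v, 'e::finite) multigraph \<Rightarrow> real ^ 'e \<Rightarrow> real" where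
  "energy2 G \<eta> = (\<Sum>e\<in>edges G. (\<eta> $ e)\<^sup>2)"

text \<open>The density at which \<open>Mod\<^sub>2\<close> of the Fulkerson dual family is attained.\<close>

definition opt_density :: "('v, 'e::finite) multigraph \<Rightarrow> real ^ 'e" where
  "opt_density G = (THE \<eta>. is_arg_min (energy2 G) (\<lambda>\<eta>. \<eta> \<in> Adm_dual G) \<eta>)"

definition homogeneous :: "('v, 'e::finite) multigraph \<Rightarrow> bool" where
  "homogeneous G \<longleftrightarrow> (\<exists>c. \<forall>e\<in>edges G. opt_density G $ e = c)"

definition H_min :: "('v, 'e::finite) multigraph \<Rightarrow> ('v, 'e) multigraph" where
  "H_min G = edge_induced G
     {e \<in> edges G. \<forall>e'\<in>edges G. opt_density G $ e \<le> opt_density G $ e'}"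

end

theory Submission
  imports Defs "HOL-Library.Transitive_Closure_Table"
begin

text \<open>Write \<open>\<eta>\<close> for the optimal density of \<open>G\<close>. The point of departure is that \<open>\<eta>\<close> is the point of
  least norm in the convex hull of the indicator vectors of the spanning trees. This is Fulkerson
  duality in the form needed here: the variational inequality for the nearest point says that
  \<open>\<eta>\<close>, divided by its squared norm, is admissible for the spanning trees, and this bounds the
  energy of all competing densities from below (\<open>opt_density_eqI\<close>,
  \<open>opt_density_characterization\<close>). Since expected overlap is the squared norm of the vector of edge
  probabilities, the pmfs optimal for MEO are those with edge probabilities \<open>\<eta>\<close>
  (\<open>meo_optimal_iff\<close>). The variational inequality then says that every fair tree is a minimum
  weight spanning tree for the weights \<open>\<eta>\<close> (\<open>fair_tree_minimum_weight\<close>).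

  The rest is an exchange argument. A minimum weight spanning tree must span each component of the
  subgraph of lightest edges, for otherwise a heavier edge could be exchanged for a lightest one
  (\<open>minimum_weight_tree_links_light_edges\<close>); this is the restriction property of \<open>H\<close>. An edge with
  both ends in \<open>H\<close> but outside \<open>H\<close> would form a cycle with any spanning tree of \<open>H\<close>, so it lies in
  no fair tree and its density is zero; but its density exceeds the minimum, which is nonnegative.
  Finally, the restriction of \<open>\<eta>\<close> to \<open>H\<close> is constant and, by the restriction property, lies in the
  hull of the spanning trees of \<open>H\<close>. As these trees all have the same number of edges
  (\<open>spanning_trees_same_card\<close>), the constant vector satisfies the variational inequality for
  \<open>H\<close>, hence is the optimal density of \<open>H\<close> (\<open>homogeneousI\<close>).\<close>

section \<open>Bridges, spanning trees and exchange\<close>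

text \<open>Several edge sets on the same vertices are compared throughout, so reachability is made a
  function of the edge set.\<close>

definition linked :: "('e \<Rightarrow> 'v set) \<Rightarrow> 'e set \<Rightarrow> 'v \<Rightarrow> 'v \<Rightarrow> bool" where
  "linked \<phi> F = (\<lambda>u v. \<exists>e\<in>F. \<phi> e = {u, v})\<^sup>*\<^sup>*"

lemma reachable_eq_linked: "reachable G = linked (ends G) (edges G)"
  unfolding reachable_def linked_def adjacent_def by (rule refl)

lemma linked_refl: "linked \<phi> F u u"
  unfolding linked_def by simp

lemma linked_trans: "linked \<phi> F u v \<Longrightarrow> linked \<phi> F v w \<Longrightarrow> linked \<phi> F u w"
  unfolding linked_def by (rule rtranclp_trans)

lemma linked_edge: "e \<in> F \<Longrightarrow> \<phi> e = {u, v} \<Longrightarrow> linked \<phi> F u v"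
  unfolding linked_def by (rule r_into_rtranclp) blast

lemma linked_sym: "linked \<phi> F u v \<Longrightarrow> linked \<phi> F v u"
proof -
  have "symp (\<lambda>u v. \<exists>e\<in>F. \<phi> e = {u, v})"
    by (rule sympI) (auto simp: insert_commute)
  from symp_rtranclp[OF this] show "linked \<phi> F u v \<Longrightarrow> linked \<phi> F v u"
    unfolding linked_def by (auto dest: sympD)
qed

lemma linked_induct [consumes 1, case_names refl step]:
  assumes "linked \<phi> F u v"
    and "P u"
    and "\<And>x y e. linked \<phi> F u x \<Longrightarrow> P x \<Longrightarrow> e \<in> F \<Longrightarrow> \<phi> e = {x, y} \<Longrightarrow> P y"
  shows "P v"
  using assms(1) unfolding linked_def
proof (induction rule: rtranclp_induct)
  case base
  show ?case by (rule assms(2))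
next
  case (step y z)
  then show ?case using assms(3) unfolding linked_def by blast
qed

lemma linked_substitute:
  assumes "linked \<phi> S u v"
    and "\<And>e x y. e \<in> S \<Longrightarrow> \<phi> e = {x, y} \<Longrightarrow> linked \<phi> T x y"
  shows "linked \<phi> T u v"
  using assms(1)
proof (induction rule: linked_induct)
  case refl
  show ?case by (rule linked_refl)
next
  case (step x y e)
  then show ?case using assms(2) linked_trans by metis
qed

lemma linked_mono: "linked \<phi> S u v \<Longrightarrow> S \<subseteq> T \<Longrightarrow> linked \<phi> T u v"
  by (erule linked_substitute) (auto intro: linked_edge)

lemma linked_insertD:
  assumes "linked \<phi> (insert f S) u v" and f: "\<phi> f = {x, y}"
  shows "linked \<phi> S u v \<or> linked \<phi> S u x \<and> linked \<phi> S y v \<or> linked \<phi> S u y \<and> linked \<phi> S x v"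
  using assms(1)
proof (induction rule: linked_induct)
  case refl
  show ?case by (simp add: linked_refl)
next
  case (step b c g)
  show ?case
  proof (cases "g \<in> S")
    case True
    then have "linked \<phi> S b c" using step by (blast intro: linked_edge)
    then show ?thesis using step.IH by (blast intro: linked_trans)
  next
    case False
    then have "{b, c} = {x, y}" using step f by auto
    then have "b = x \<and> c = y \<or> b = y \<and> c = x" by (auto simp: doubleton_eq_iff)
    then show ?thesis using step.IH linked_refl by metis
  qed
qed

lemma linked_within_closed:
  assumes "linked \<phi> S u v" and "u \<in> C"
    and closed: "\<And>e x y. e \<in> S \<Longrightarrow> \<phi> e = {x, y} \<Longrightarrow> x \<in> C \<Longrightarrow> y \<in> C"
  shows "v \<in> C \<and> linked \<phi> {e \<in> S. \<phi> e \<subseteq> C} u v"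
  using assms(1)
proof (induction rule: linked_induct)
  case refl
  show ?case using assms(2) by (simp add: linked_refl)
next
  case (step x y e)
  then have "y \<in> C" using closed by blast
  with step have "linked \<phi> {e \<in> S. \<phi> e \<subseteq> C} x y"
    by (intro linked_edge[of e]) auto
  with step \<open>y \<in> C\<close> show ?case by (blast intro: linked_trans)
qed

text \<open>The last edge of a cycle is bypassed by the rest of the cycle.\<close>

lemma cycle_imp_bypassed_edge:
  assumes "is_cycle G vs es"
  shows "\<exists>e\<in>edges G. \<exists>u v. ends G e = {u, v} \<and> linked (ends G) (edges G - {e}) u v"
proof -
  define n where "n = length es"
  have n: "n > 0" "length vs = n" and d: "distinct es" and sub: "set es \<subseteq> edges G"
    and en: "\<And>i. i < n \<Longrightarrow> ends G (es ! i) = {vs ! i, vs ! (Suc i mod n)}"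
    using assms unfolding is_cycle_def n_def by auto
  define e where "e = es ! (n - 1)"
  have "e \<in> edges G" using n sub unfolding e_def n_def by auto
  moreover have "ends G e = {vs ! 0, vs ! (n - 1)}"
    using en[of "n - 1"] n unfolding e_def by (auto simp: insert_commute)
  moreover have "i < n \<Longrightarrow> linked (ends G) (edges G - {e}) (vs ! 0) (vs ! i)" for i
  proof (induction i)
    case 0
    show ?case by (rule linked_refl)
  next
    case (Suc i)
    have "es ! i \<noteq> e"
      using Suc.prems d unfolding e_def n_def by (auto simp: nth_eq_iff_index_eq)
    moreover have "es ! i \<in> edges G" using Suc.prems sub unfolding n_def by auto
    moreover have "ends G (es ! i) = {vs ! i, vs ! Suc i}" using en[of i] Suc.prems by simp
    ultimately have "linked (ends G) (edges G - {e}) (vs ! i) (vs ! Suc i)"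
      by (intro linked_edge[of "es ! i"]) auto
    then show ?case using Suc by (auto intro: linked_trans)
  qed
  ultimately show ?thesis using n by (metis diff_less zero_less_one)
qed

text \<open>A repetition-free walk avoiding \<open>e\<close> between the ends of \<open>e\<close> is closed up by \<open>e\<close>. Its edges
  are automatically distinct, because their end sets are. A self-loop is the case of the walk
  without edges.\<close>

lemma bypassed_edge_imp_cycle:
  assumes fin: "finite_multigraph G" and e: "e \<in> edges G" "ends G e = {u, v}"
    and link: "linked (ends G) (edges G - {e}) u v"
  shows "\<exists>vs es. is_cycle G vs es"
proof -
  let ?R = "\<lambda>u v. \<exists>e'\<in>edges G - {e}. ends G e' = {u, v}"
  obtain ys where "rtrancl_path ?R u ys v"
    using link unfolding linked_def by (auto simp: rtranclp_eq_rtrancl_path)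
  then obtain xs where path: "rtrancl_path ?R u xs v" and dist: "distinct (u # xs)"
    by (rule rtrancl_path_distinct)
  define n where "n = length xs"
  define vs where "vs = u # xs"
  have len: "length vs = Suc n" by (simp add: vs_def n_def)
  have "\<forall>i\<in>{..<n}. \<exists>g. g \<in> edges G - {e} \<and> ends G g = {vs ! i, vs ! Suc i}"
    using rtrancl_path_nth[OF path] unfolding vs_def n_def by auto
  then obtain g where g: "\<And>i. i < n \<Longrightarrow> g i \<in> edges G - {e}"
      "\<And>i. i < n \<Longrightarrow> ends G (g i) = {vs ! i, vs ! Suc i}"
    by (metis lessThan_iff)
  have vn: "vs ! n = v"
  proof (cases "xs = []")
    case True
    then show ?thesis using path unfolding vs_def n_def by (auto elim: rtrancl_path.cases)
  next
    case False
    then show ?thesis using rtrancl_path_last[OF path] unfolding vs_def n_def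
      by (simp add: last_conv_nth nth_Cons')
  qed
  define es where "es = map g [0..<n] @ [e]"
  have es: "length es = Suc n" "\<And>i. i < n \<Longrightarrow> es ! i = g i" "es ! n = e"
    by (auto simp: es_def nth_append)
  have "inj_on g {..<n}"
  proof (rule inj_onI)
    fix i j assume ij: "i \<in> {..<n}" "j \<in> {..<n}" "g i = g j"
    then have "{vs ! i, vs ! Suc i} = {vs ! j, vs ! Suc j}" using g(2) by (metis lessThan_iff)
    moreover have "vs ! a = vs ! b \<longleftrightarrow> a = b" if "a \<le> n" "b \<le> n" for a b
      using dist that len unfolding vs_def[symmetric] by (simp add: nth_eq_iff_index_eq)
    ultimately show "i = j" using ij by (auto simp: doubleton_eq_iff)
  qed
  then have "distinct es" using g(1) by (auto simp: es_def distinct_map atLeast0LessThan)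
  moreover have ends: "ends G (es ! i) = {vs ! i, vs ! (Suc i mod length vs)}" if "i < length es" for i
  proof (cases "i = n")
    case True
    then show ?thesis using e vn len es by (simp add: vs_def insert_commute)
  next
    case False
    then show ?thesis using that g len es by simp
  qed
  moreover have sub: "set es \<subseteq> edges G" using g(1) e by (auto simp: es_def)
  moreover have "set vs \<subseteq> verts G"
  proof
    fix x assume "x \<in> set vs"
    then obtain i where "i < length es" "x = vs ! i" using len es by (auto simp: in_set_conv_nth)
    then have "x \<in> ends G (es ! i)" "es ! i \<in> edges G" using ends sub by auto
    then show "x \<in> verts G" using fin unfolding finite_multigraph_def by blast
  qed
  moreover have "es \<noteq> []" by (simp add: es_def)
  ultimately show ?thesis using dist len es unfolding is_cycle_def vs_def[symmetric] by metis
qed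

text \<open>An edge lies on a cycle if and only if it is not a bridge. All later arguments about trees use
  this description by bridges, which involves no cycles.\<close>

lemma spanning_trees_iff:
  assumes "finite_multigraph G"
  shows "\<gamma> \<in> spanning_trees G \<longleftrightarrow> \<gamma> \<subseteq> edges G \<and> verts G \<noteq> {} \<and>
    (\<forall>u\<in>verts G. \<forall>v\<in>verts G. linked (ends G) \<gamma> u v) \<and>
    (\<forall>e\<in>\<gamma>. \<forall>u v. ends G e = {u, v} \<longrightarrow> \<not> linked (ends G) (\<gamma> - {e}) u v)"
proof (cases "\<gamma> \<subseteq> edges G")
  case True
  then have "finite_multigraph (G\<lparr>edges := \<gamma>\<rparr>)"
    using assms unfolding finite_multigraph_def by (auto intro: finite_subset)
  then have "(\<exists>vs es. is_cycle (G\<lparr>edges := \<gamma>\<rparr>) vs es) \<longleftrightarrow>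
    (\<exists>e\<in>\<gamma>. \<exists>u v. ends G e = {u, v} \<and> linked (ends G) (\<gamma> - {e}) u v)"
    using cycle_imp_bypassed_edge[of "G\<lparr>edges := \<gamma>\<rparr>"] bypassed_edge_imp_cycle[of "G\<lparr>edges := \<gamma>\<rparr>"]
    by auto
  then show ?thesis
    using True
    unfolding spanning_trees_def is_tree_def graph_connected_def reachable_eq_linked by auto
qed (simp add: spanning_trees_def)

lemma finite_spanning_trees: "finite_multigraph G \<Longrightarrow> finite (spanning_trees G)"
  unfolding spanning_trees_def finite_multigraph_def
  by (rule finite_subset[of _ "Pow (edges G)"]) auto

text \<open>An inclusion-minimal connected edge set is a spanning tree.\<close>

lemma spanning_tree_exists:
  assumes fin: "finite_multigraph G" and con: "graph_connected G"
  shows "spanning_trees G \<noteq> {}"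
proof -
  let ?P = "\<lambda>T. T \<subseteq> edges G \<and> (\<forall>u\<in>verts G. \<forall>v\<in>verts G. linked (ends G) T u v)"
  have "finite (edges G)" using fin unfolding finite_multigraph_def by simp
  then have "finite (Collect ?P)" by (auto intro: finite_subset[of _ "Pow (edges G)"])
  moreover have "edges G \<in> Collect ?P"
    using con unfolding graph_connected_def reachable_eq_linked by simp
  then have "Collect ?P \<noteq> {}" by (metis empty_iff)
  ultimately have "\<exists>T\<in>Collect ?P. \<forall>S\<in>Collect ?P. S \<subseteq> T \<longrightarrow> T = S"
    by (rule finite_has_minimal)
  then obtain T where T: "?P T" and min: "\<And>S. ?P S \<Longrightarrow> S \<subseteq> T \<Longrightarrow> T = S"
    unfolding Ball_def Bex_def mem_Collect_eq by metis
  have "\<not> linked (ends G) (T - {e}) u v" if e: "e \<in> T" "ends G e = {u, v}" for e u v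
  proof
    assume l: "linked (ends G) (T - {e}) u v"
    have "linked (ends G) (T - {e}) a b" if "linked (ends G) T a b" for a b
      using that
    proof (rule linked_substitute)
      fix g x y assume g: "g \<in> T" "ends G g = {x, y}"
      show "linked (ends G) (T - {e}) x y"
      proof (cases "g = e")
        case True
        then show ?thesis using l linked_sym[OF l] g e by (auto simp: doubleton_eq_iff)
      next
        case False
        then show ?thesis using g by (intro linked_edge[of g]) auto
      qed
    qed
    then have "?P (T - {e})" using T by blast
    then show False using min[of "T - {e}"] e by blast
  qed
  then have "T \<in> spanning_trees G"
    using T con unfolding spanning_trees_iff[OF fin] graph_connected_def by blast
  then show ?thesis by blast
qed

text \<open>The edge to be removed is taken from an inclusion-minimal subset of \<open>\<gamma>\<close> linking \<open>u\<close> to \<open>v\<close>,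
  that is, from the path of the tree; this path leaves \<open>A\<close> somewhere. Prescribing where the removed
  edge must not lie is what makes the lemma serve both for comparing weights and for comparing
  cardinalities.\<close>

lemma spanning_tree_exchange:
  assumes fin: "finite_multigraph G" and \<gamma>: "\<gamma> \<in> spanning_trees G"
    and e: "e \<in> edges G" "ends G e = {u, v}"
    and A: "\<not> linked (ends G) (\<gamma> \<inter> A) u v"
  obtains f where "f \<in> \<gamma> - A" "insert e (\<gamma> - {f}) \<in> spanning_trees G"
proof -
  let ?L = "linked (ends G)"
  note iff = spanning_trees_iff[OF fin]
  have sub: "\<gamma> \<subseteq> edges G" and ne: "verts G \<noteq> {}"
    and con: "\<And>a b. a \<in> verts G \<Longrightarrow> b \<in> verts G \<Longrightarrow> ?L \<gamma> a b"
    and bridge: "\<And>g a b. g \<in> \<gamma> \<Longrightarrow> ends G g = {a, b} \<Longrightarrow> \<not> ?L (\<gamma> - {g}) a b"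
    using \<gamma> unfolding iff by auto
  have uv: "u \<in> verts G" "v \<in> verts G" using e fin unfolding finite_multigraph_def by auto
  have "finite \<gamma>" using sub fin unfolding finite_multigraph_def by (auto intro: finite_subset)
  let ?Q = "\<lambda>S. S \<subseteq> \<gamma> \<and> ?L S u v"
  have "finite (Collect ?Q)" using \<open>finite \<gamma>\<close> by (auto intro: finite_subset[of _ "Pow \<gamma>"])
  moreover have "\<gamma> \<in> Collect ?Q" using con uv by simp
  then have "Collect ?Q \<noteq> {}" by (metis empty_iff)
  ultimately have "\<exists>S\<in>Collect ?Q. \<forall>T\<in>Collect ?Q. T \<subseteq> S \<longrightarrow> S = T"
    by (rule finite_has_minimal)
  then obtain S where S: "S \<subseteq> \<gamma>" "?L S u v"
    and min: "\<And>T. T \<subseteq> \<gamma> \<Longrightarrow> ?L T u v \<Longrightarrow> T \<subseteq> S \<Longrightarrow> S = T"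
    unfolding Ball_def Bex_def mem_Collect_eq by metis
  have "\<not> S \<subseteq> A" using A S linked_mono[of "ends G" S u v "\<gamma> \<inter> A"] by blast
  then obtain f where f: "f \<in> S" "f \<notin> A" by blast
  have "card (ends G f) = 1 \<or> card (ends G f) = 2"
    using f S sub fin unfolding finite_multigraph_def by blast
  then obtain x y where xy: "ends G f = {x, y}"
    by (auto simp: card_1_singleton_iff card_2_iff)
  have "\<not> ?L (S - {f}) u v" using min[of "S - {f}"] f S by blast
  moreover have "?L (insert f (S - {f})) u v" using S f by (simp add: insert_absorb)
  ultimately have "?L (S - {f}) u x \<and> ?L (S - {f}) y v \<or> ?L (S - {f}) u y \<and> ?L (S - {f}) x v"
    using linked_insertD[of "ends G" f "S - {f}" u v x y] xy by metis
  then have split: "?L (\<gamma> - {f}) u x \<and> ?L (\<gamma> - {f}) y v \<or> ?L (\<gamma> - {f}) u y \<and> ?L (\<gamma> - {f}) x v"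
    using S by (meson Diff_mono linked_mono subset_refl)
  have cut: "\<not> ?L (\<gamma> - {f}) u v"
    using split bridge[OF _ xy] f S linked_sym[of "ends G" "\<gamma> - {f}"]
      linked_trans[of "ends G" "\<gamma> - {f}"]
    by (metis subsetD)
  let ?\<gamma> = "insert e (\<gamma> - {f})"
  have xy': "?L ?\<gamma> x y"
  proof -
    have m: "?L (\<gamma> - {f}) a b \<Longrightarrow> ?L ?\<gamma> a b" for a b by (erule linked_mono) blast
    have "?L ?\<gamma> u v" using e by (intro linked_edge[of e]) auto
    then show ?thesis
      using split m linked_sym[of "ends G" ?\<gamma>] linked_trans[of "ends G" ?\<gamma>] by metis
  qed
  have "?L ?\<gamma> a b" if "a \<in> verts G" "b \<in> verts G" for a b
    using con[OF that]
  proof (rule linked_substitute)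
    fix g a b assume g: "g \<in> \<gamma>" "ends G g = {a, b}"
    show "?L ?\<gamma> a b"
    proof (cases "g = f")
      case True
      then show ?thesis using g xy xy' linked_sym[OF xy'] by (auto simp: doubleton_eq_iff)
    next
      case False
      then show ?thesis using g by (intro linked_edge[of g]) auto
    qed
  qed
  moreover have "\<not> ?L (?\<gamma> - {g}) a b" if g: "g \<in> ?\<gamma>" "ends G g = {a, b}" for g a b
  proof (cases "g = e")
    case True
    then have "{a, b} = {u, v}" using g e by simp
    then have "\<not> ?L (\<gamma> - {f}) a b"
      using cut linked_sym[of "ends G" "\<gamma> - {f}"] by (auto simp: doubleton_eq_iff)
    then show ?thesis using True linked_mono[of "ends G" "?\<gamma> - {g}" a b "\<gamma> - {f}"] by blast
  next
    case False
    let ?R = "\<gamma> - {f} - {g}"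
    have gm: "g \<in> \<gamma>" "g \<noteq> f" using g False by auto
    have m: "?L ?R c d \<Longrightarrow> ?L (\<gamma> - {f}) c d" for c d by (erule linked_mono) blast
    have ab: "?L (\<gamma> - {f}) a b" using gm g by (intro linked_edge[of g]) auto
    show ?thesis
    proof
      assume "?L (?\<gamma> - {g}) a b"
      moreover have "?\<gamma> - {g} = insert e ?R" using False by auto
      ultimately have "?L ?R a b \<or> ?L ?R a u \<and> ?L ?R v b \<or> ?L ?R a v \<and> ?L ?R u b"
        using linked_insertD[of "ends G" e ?R a b u v] e by simp
      moreover have "\<not> ?L ?R a b"
        using bridge[OF gm(1) g(2)] linked_mono[of "ends G" ?R a b "\<gamma> - {g}"] by blast
      ultimately have "?L (\<gamma> - {f}) u v"
        using m ab linked_sym[of "ends G" "\<gamma> - {f}"] linked_trans[of "ends G" "\<gamma> - {f}"] by metis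
      with cut show False by blast
    qed
  qed
  ultimately have "?\<gamma> \<in> spanning_trees G" using ne sub e unfolding iff by blast
  moreover have "f \<in> \<gamma> - A" using f S by blast
  ultimately show ?thesis by (rule that[rotated])
qed

text \<open>Exchanging edges one at a time moves \<open>\<gamma>\<close> to \<open>\<tau>\<close> without changing the number of edges: if
  \<open>e\<close> is an edge of \<open>\<tau>\<close> outside \<open>\<gamma>\<close>, then \<open>\<tau> - {e}\<close> does not link the ends of \<open>e\<close>, so an edge
  outside \<open>\<tau>\<close> can make room for \<open>e\<close>.\<close>

lemma spanning_trees_same_card:
  assumes fin: "finite_multigraph G" and "\<gamma> \<in> spanning_trees G" and \<tau>: "\<tau> \<in> spanning_trees G"
  shows "card \<gamma> = card \<tau>"
  using assms(2)
proof (induction "card (\<tau> - \<gamma>)" arbitrary: \<gamma> rule: less_induct)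
  case less
  let ?L = "linked (ends G)"
  have finE: "finite (edges G)" using fin unfolding finite_multigraph_def by simp
  have \<tau>D: "\<tau> \<subseteq> edges G" "\<And>a b. a \<in> verts G \<Longrightarrow> b \<in> verts G \<Longrightarrow> ?L \<tau> a b"
      "\<And>g a b. g \<in> \<tau> \<Longrightarrow> ends G g = {a, b} \<Longrightarrow> \<not> ?L (\<tau> - {g}) a b"
    using \<tau> unfolding spanning_trees_iff[OF fin] by auto
  have \<gamma>D: "\<gamma> \<subseteq> edges G"
      "\<And>g a b. g \<in> \<gamma> \<Longrightarrow> ends G g = {a, b} \<Longrightarrow> \<not> ?L (\<gamma> - {g}) a b"
    using less.prems unfolding spanning_trees_iff[OF fin] by auto
  have two: "\<exists>u v. ends G e = {u, v} \<and> u \<in> verts G \<and> v \<in> verts G" if "e \<in> edges G" for e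
    using that fin unfolding finite_multigraph_def
    by (fastforce simp: card_1_singleton_iff card_2_iff)
  have fins: "finite \<gamma>" "finite \<tau>" using \<gamma>D \<tau>D finE by (auto intro: finite_subset)
  show ?case
  proof (cases "\<tau> \<subseteq> \<gamma>")
    case True
    have "e \<in> \<tau>" if e: "e \<in> \<gamma>" for e
    proof (rule ccontr)
      assume "e \<notin> \<tau>"
      obtain u v where uv: "ends G e = {u, v}" "u \<in> verts G" "v \<in> verts G" using two \<gamma>D e by blast
      then have "?L (\<gamma> - {e}) u v"
        using \<tau>D(2) linked_mono[of "ends G" \<tau> u v "\<gamma> - {e}"] True \<open>e \<notin> \<tau>\<close> by blast
      then show False using \<gamma>D e uv by blast
    qed
    then show ?thesis using True by (metis subsetI subset_antisym)
  next
    case False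
    then obtain e where e: "e \<in> \<tau>" "e \<notin> \<gamma>" by blast
    obtain u v where uv: "ends G e = {u, v}" using two[of e] \<tau>D(1) e(1) by blast
    have "\<not> ?L (\<gamma> \<inter> (\<tau> - {e})) u v"
      using \<tau>D(3)[OF e(1) uv] linked_mono[of "ends G" "\<gamma> \<inter> (\<tau> - {e})" u v "\<tau> - {e}"] by blast
    then obtain f where f: "f \<in> \<gamma> - (\<tau> - {e})" "insert e (\<gamma> - {f}) \<in> spanning_trees G"
      using spanning_tree_exchange[OF fin less.prems subsetD[OF \<tau>D(1) e(1)] uv] by metis
    have "\<tau> - insert e (\<gamma> - {f}) \<subset> \<tau> - \<gamma>" using e f by auto
    then have "card (\<tau> - insert e (\<gamma> - {f})) < card (\<tau> - \<gamma>)"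
      using fins by (intro psubset_card_mono) auto
    then have "card (insert e (\<gamma> - {f})) = card \<tau>" using less.hyps f by blast
    moreover have "card (insert e (\<gamma> - {f})) = card \<gamma>"
      using e f fins by (metis DiffE card.remove card_insert_disjoint finite_Diff)
    ultimately show ?thesis by simp
  qed
qed

section \<open>The optimal density as a point of least norm\<close>

text \<open>The indicator vector, defined for arbitrary edge sets since it also serves for
  \<open>edges G\<close> and for all labels.\<close>

definition tree_vector :: "'e set \<Rightarrow> real ^ 'e::finite" where
  "tree_vector \<gamma> = (\<chi> e. if e \<in> \<gamma> then 1 else 0)"

abbreviation tree_hull :: "('v, 'e::finite) multigraph \<Rightarrow> (real ^ 'e) set" where
  "tree_hull G \<equiv> convex hull (tree_vector ` spanning_trees G)"

lemma tree_vector_nth: "tree_vector \<gamma> $ e = (if e \<in> \<gamma> then 1 else 0)"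
  by (simp add: tree_vector_def)

lemma inner_tree_vector: "x \<bullet> tree_vector \<gamma> = (\<Sum>e\<in>\<gamma>. x $ e)"
proof -
  have "x \<bullet> tree_vector \<gamma> = (\<Sum>e\<in>UNIV. if e \<in> \<gamma> then x $ e else 0)"
    unfolding inner_vec_def by (rule sum.cong) (auto simp: tree_vector_nth)
  also have "\<dots> = (\<Sum>e\<in>\<gamma>. x $ e)" by (simp add: sum.If_cases)
  finally show ?thesis .
qed

lemma tree_vector_inner: "tree_vector \<gamma> \<bullet> tree_vector \<gamma>' = real (card (\<gamma> \<inter> \<gamma>'))"
proof -
  have "(\<Sum>e\<in>\<gamma>'. tree_vector \<gamma> $ e) = (\<Sum>e\<in>\<gamma>' \<inter> \<gamma>. 1)"
    by (subst sum.inter_restrict) (auto simp: tree_vector_nth intro: sum.cong)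
  then show ?thesis by (simp add: inner_tree_vector Int_commute)
qed

lemma inner_nonneg_vectors:
  assumes "x \<in> nonneg_vectors E"
  shows "x \<bullet> y = (\<Sum>e\<in>E. x $ e * y $ e)"
  using assms unfolding inner_vec_def nonneg_vectors_def inner_real_def
  by (intro sum.mono_neutral_right) auto

lemma convex_nonneg_vectors: "convex (nonneg_vectors E)"
  unfolding convex_def nonneg_vectors_def by auto

lemma closed_nonneg_vectors: "closed (nonneg_vectors E)"
proof -
  have "nonneg_vectors E = (\<Inter>e\<in>E. {x. 0 \<le> x $ e}) \<inter> (\<Inter>e\<in>-E. {x. x $ e = 0})"
    unfolding nonneg_vectors_def by auto
  then show ?thesis by (auto intro!: closed_Collect_le closed_Collect_eq continuous_intros)
qed

lemma Adm_eq: "Adm G = nonneg_vectors (edges G) \<inter>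
    (\<Inter>\<gamma>\<in>spanning_trees G. {x. tree_vector \<gamma> \<bullet> x \<ge> 1})"
  unfolding Adm_def by (auto simp: inner_tree_vector inner_commute[of "tree_vector _"])

lemma convex_Adm: "convex (Adm G)"
  unfolding Adm_eq
  by (intro convex_Int convex_nonneg_vectors convex_INT convex_halfspace_ge)

lemma closed_Adm: "closed (Adm G)"
  unfolding Adm_eq
  by (intro closed_Int closed_nonneg_vectors closed_INT ballI closed_halfspace_ge)

text \<open>The constraints defining the dual are imposed at the extreme points of \<open>Adm G\<close> only. They
  extend to all of \<open>Adm G\<close> because a linear functional that is positive on every edge has bounded
  sublevel sets there, and so attains its minimum at an extreme point. Some entries of \<open>\<eta>\<close> may be
  zero, so the argument is applied to \<open>\<eta> + \<epsilon> *\<^sub>R tree_vector (edges G)\<close>, and \<open>\<epsilon>\<close> then tends to zero.\<close>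

lemma Adm_dual_inner_Adm:
  assumes \<eta>: "\<eta> \<in> Adm_dual G" and \<rho>: "\<rho> \<in> Adm G"
  shows "1 \<le> \<rho> \<bullet> \<eta>"
proof -
  let ?E = "edges G"
  have \<eta>0: "\<And>e. e \<in> ?E \<Longrightarrow> 0 \<le> \<eta> $ e" using \<eta> unfolding Adm_dual_def nonneg_vectors_def by auto
  have nn: "\<sigma> \<in> nonneg_vectors ?E" if "\<sigma> \<in> Adm G" for \<sigma> using that unfolding Adm_def by simp
  have pos: "0 \<le> \<sigma> $ e" if "\<sigma> \<in> Adm G" for \<sigma> e
    using nn[OF that] unfolding nonneg_vectors_def by (cases "e \<in> ?E") auto
  have key: "1 \<le> \<rho> \<bullet> (\<eta> + \<epsilon> *\<^sub>R tree_vector ?E)" if \<epsilon>: "\<epsilon> > 0" for \<epsilon>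
  proof -
    define h where "h = \<eta> + \<epsilon> *\<^sub>R tree_vector ?E"
    have h: "\<epsilon> \<le> h $ e" "\<eta> $ e \<le> h $ e" if "e \<in> ?E" for e
      using \<eta>0[OF that] \<epsilon> that by (auto simp: h_def tree_vector_nth)
    have inner_h: "\<sigma> \<bullet> h = (\<Sum>e\<in>?E. \<sigma> $ e * h $ e)" if "\<sigma> \<in> Adm G" for \<sigma>
      using nn[OF that] by (rule inner_nonneg_vectors)
    define K where "K = Adm G \<inter> {\<sigma>. h \<bullet> \<sigma> \<le> h \<bullet> \<rho>}"
    have coord: "\<epsilon> * \<sigma> $ e \<le> h \<bullet> \<rho>" if "\<sigma> \<in> K" "e \<in> ?E" for \<sigma> e
    proof -
      have \<sigma>: "\<sigma> \<in> Adm G" "\<sigma> \<bullet> h \<le> h \<bullet> \<rho>" using that by (auto simp: K_def inner_commute)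
      have "\<epsilon> * \<sigma> $ e \<le> \<sigma> $ e * h $ e"
        using mult_left_mono[OF h(1)[OF that(2)] pos[OF \<sigma>(1)]] by (simp add: mult.commute)
      also have "\<dots> \<le> (\<Sum>e\<in>?E. \<sigma> $ e * h $ e)"
        using that(2) pos[OF \<sigma>(1)] h(1) \<epsilon>
        by (intro member_le_sum) (auto intro!: mult_nonneg_nonneg order_trans[OF less_imp_le h(1)])
      finally show ?thesis using \<sigma> inner_h by simp
    qed
    have "K \<subseteq> cbox 0 (\<chi> e. \<bar>h \<bullet> \<rho>\<bar> / \<epsilon>)"
    proof
      fix \<sigma> assume \<sigma>: "\<sigma> \<in> K"
      then have A: "\<sigma> \<in> Adm G" by (simp add: K_def)
      have "\<sigma> $ e \<le> \<bar>h \<bullet> \<rho>\<bar> / \<epsilon>" for e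
      proof (cases "e \<in> ?E")
        case True
        then show ?thesis using coord[OF \<sigma> True] \<epsilon> by (simp add: field_simps)
      next
        case False
        then show ?thesis using nn[OF A] \<epsilon> by (simp add: nonneg_vectors_def)
      qed
      then show "\<sigma> \<in> cbox 0 (\<chi> e. \<bar>h \<bullet> \<rho>\<bar> / \<epsilon>)" using pos[OF A] by (simp add: mem_box_cart)
    qed
    then have "bounded K" by (rule bounded_subset[OF bounded_cbox])
    moreover have "closed K" unfolding K_def by (intro closed_Int closed_Adm closed_halfspace_le)
    ultimately have "compact K" by (simp add: compact_eq_bounded_closed)
    moreover have "\<rho> \<in> K" using \<rho> by (simp add: K_def)
    moreover have "continuous_on K (\<lambda>\<sigma>. h \<bullet> \<sigma>)" by (intro continuous_intros)
    ultimately obtain \<sigma>\<^sub>0 where \<sigma>\<^sub>0: "\<sigma>\<^sub>0 \<in> K" "\<And>\<sigma>. \<sigma> \<in> K \<Longrightarrow> h \<bullet> \<sigma>\<^sub>0 \<le> h \<bullet> \<sigma>"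
      using continuous_attains_inf[of K "\<lambda>\<sigma>. h \<bullet> \<sigma>"] by blast
    have min: "h \<bullet> \<sigma>\<^sub>0 \<le> h \<bullet> \<sigma>" if "\<sigma> \<in> Adm G" for \<sigma>
      using \<sigma>\<^sub>0 that by (cases "\<sigma> \<in> K") (auto simp: K_def)
    define F where "F = Adm G \<inter> {\<sigma>. h \<bullet> \<sigma> = h \<bullet> \<sigma>\<^sub>0}"
    have face: "F face_of Adm G"
      unfolding F_def using min by (intro face_of_Int_supporting_hyperplane_ge convex_Adm) auto
    have "F \<subseteq> K" using \<sigma>\<^sub>0(1) unfolding F_def K_def by auto
    moreover have "closed F" unfolding F_def by (intro closed_Int closed_Adm closed_hyperplane)
    ultimately have "compact F" using \<open>compact K\<close> by (metis compact_Int_closed inf.absorb_iff2)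
    moreover have "F \<noteq> {}" using \<sigma>\<^sub>0(1) unfolding F_def K_def by auto
    ultimately obtain x where "x extreme_point_of F"
      using extreme_point_exists_convex face_of_imp_convex[OF face] by blast
    then have x: "x extreme_point_of Adm G" "x \<in> F"
      using extreme_point_of_face[OF face] by auto
    then have xA: "x \<in> Adm G" unfolding F_def by simp
    have "1 \<le> (\<Sum>e\<in>?E. x $ e * \<eta> $ e)"
      using \<eta> x(1) unfolding Adm_dual_def fulkerson_dual_def by simp
    also have "\<dots> \<le> (\<Sum>e\<in>?E. x $ e * h $ e)"
      using h(2) pos[OF xA] by (intro sum_mono mult_left_mono) auto
    also have "\<dots> = h \<bullet> x" using inner_h[OF xA] by (simp add: inner_commute)
    also have "\<dots> \<le> h \<bullet> \<rho>" using x(2) min[OF \<rho>] unfolding F_def by simp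
    finally show ?thesis by (simp add: h_def inner_commute)
  qed
  have "((\<lambda>\<epsilon>. \<rho> \<bullet> (\<eta> + \<epsilon> *\<^sub>R tree_vector ?E)) \<longlongrightarrow> \<rho> \<bullet> (\<eta> + 0 *\<^sub>R tree_vector ?E)) (at_right (0::real))"
    by (intro tendsto_intros)
  moreover have "\<forall>\<^sub>F \<epsilon> in at_right (0::real). 1 \<le> \<rho> \<bullet> (\<eta> + \<epsilon> *\<^sub>R tree_vector ?E)"
    unfolding eventually_at_right_field using key by (auto intro: exI[of _ 1])
  ultimately have "1 \<le> \<rho> \<bullet> (\<eta> + 0 *\<^sub>R tree_vector ?E)"
    by (intro tendsto_lowerbound) auto
  then show ?thesis by simp
qed

lemma tree_hull_subset_nonneg: "tree_hull G \<subseteq> nonneg_vectors (edges G)"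
  by (intro hull_minimal convex_nonneg_vectors)
    (auto simp: nonneg_vectors_def tree_vector_nth spanning_trees_def)

lemma tree_hull_subset_Adm_dual: "tree_hull G \<subseteq> Adm_dual G"
proof
  fix p assume p: "p \<in> tree_hull G"
  have "1 \<le> (\<Sum>e\<in>edges G. \<rho> $ e * p $ e)" if "\<rho> \<in> fulkerson_dual G" for \<rho>
  proof -
    have A: "\<rho> \<in> Adm G" using that unfolding fulkerson_dual_def extreme_point_of_def by simp
    then have "tree_hull G \<subseteq> {x. \<rho> \<bullet> x \<ge> 1}"
      by (intro hull_minimal convex_halfspace_ge) (auto simp: Adm_def inner_tree_vector)
    moreover have "\<rho> \<in> nonneg_vectors (edges G)" using A by (simp add: Adm_def)
    ultimately show ?thesis using p inner_nonneg_vectors by fastforce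
  qed
  then show "p \<in> Adm_dual G"
    using p tree_hull_subset_nonneg unfolding Adm_dual_def by blast
qed

text \<open>The last hypothesis is the variational inequality for the point of the hull nearest to
  the origin. After division of \<open>p\<close> by its squared norm it becomes admissibility for the spanning
  trees, and duality turns this into a lower bound on the energy of every competitor.\<close>

lemma opt_density_eqI:
  fixes G :: "('v, 'e::finite) multigraph"
  assumes nonempty: "{} \<notin> spanning_trees G" and p: "p \<in> tree_hull G"
    and var: "\<And>\<gamma>. \<gamma> \<in> spanning_trees G \<Longrightarrow> p \<bullet> p \<le> p \<bullet> tree_vector \<gamma>"
  shows "opt_density G = p"
proof -
  have nn: "p \<in> nonneg_vectors (edges G)" using p tree_hull_subset_nonneg by blast
  have "tree_hull G \<subseteq> {x. tree_vector UNIV \<bullet> x \<ge> 1}"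
  proof (intro hull_minimal convex_halfspace_ge subsetI)
    fix x :: "real ^ 'e" assume "x \<in> tree_vector ` spanning_trees G"
    then obtain \<gamma> where "\<gamma> \<in> spanning_trees G" "x = tree_vector \<gamma>" by blast
    moreover then have "card \<gamma> \<ge> 1" using nonempty by (metis card_gt_0_iff finite less_eq_Suc_le One_nat_def)
    ultimately show "x \<in> {x. tree_vector UNIV \<bullet> x \<ge> 1}" by (simp add: tree_vector_inner)
  qed
  then have "p \<noteq> 0" using p by force
  then have pp: "p \<bullet> p > 0" by simp
  have "p /\<^sub>R (p \<bullet> p) \<in> Adm G"
    unfolding Adm_def
  proof (intro CollectI conjI ballI)
    show "p /\<^sub>R (p \<bullet> p) \<in> nonneg_vectors (edges G)"
      using nn pp unfolding nonneg_vectors_def by simp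
    fix \<gamma> assume "\<gamma> \<in> spanning_trees G"
    then have "1 \<le> (p \<bullet> tree_vector \<gamma>) / (p \<bullet> p)" using var pp by simp
    then show "1 \<le> (\<Sum>e\<in>\<gamma>. (p /\<^sub>R (p \<bullet> p)) $ e)"
      by (simp add: inner_tree_vector sum_distrib_left divide_inverse mult.commute)
  qed
  then have "1 \<le> (p /\<^sub>R (p \<bullet> p)) \<bullet> \<eta>" if "\<eta> \<in> Adm_dual G" for \<eta>
    by (rule Adm_dual_inner_Adm[OF that])
  then have low: "p \<bullet> p \<le> p \<bullet> \<eta>" if "\<eta> \<in> Adm_dual G" for \<eta>
    using that pp by (simp add: field_simps)
  have energy: "energy2 G \<eta> = \<eta> \<bullet> \<eta>" if "\<eta> \<in> Adm_dual G" for \<eta>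
    using that inner_nonneg_vectors[of \<eta> "edges G" \<eta>]
    unfolding Adm_dual_def energy2_def by (simp add: power2_eq_square)
  have gap: "p \<bullet> p + (\<eta> - p) \<bullet> (\<eta> - p) \<le> \<eta> \<bullet> \<eta>" if "\<eta> \<in> Adm_dual G" for \<eta>
    using low[OF that] by (simp add: inner_diff inner_commute)
  have pA: "p \<in> Adm_dual G" using p tree_hull_subset_Adm_dual by blast
  show ?thesis
    unfolding opt_density_def
  proof (rule the_equality)
    have "energy2 G p \<le> energy2 G \<eta>" if "\<eta> \<in> Adm_dual G" for \<eta>
      using gap[OF that] energy[OF that] energy[OF pA] inner_ge_zero[of "\<eta> - p"] by linarith
    then show "is_arg_min (energy2 G) (\<lambda>\<eta>. \<eta> \<in> Adm_dual G) p"
      using pA unfolding is_arg_min_def by (auto simp: not_less)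
  next
    fix \<eta> assume "is_arg_min (energy2 G) (\<lambda>\<eta>. \<eta> \<in> Adm_dual G) \<eta>"
    then have \<eta>: "\<eta> \<in> Adm_dual G" "\<eta> \<bullet> \<eta> \<le> p \<bullet> p"
      using pA energy unfolding is_arg_min_def by (auto simp: not_less)
    then have "(\<eta> - p) \<bullet> (\<eta> - p) \<le> 0" using gap by fastforce
    then show "\<eta> = p" by (metis inner_gt_zero_iff not_less right_minus_eq)
  qed
qed

lemma empty_not_spanning_tree:
  assumes fin: "finite_multigraph G" and "loopless G" and "edges G \<noteq> {}"
  shows "{} \<notin> spanning_trees G"
proof
  assume "{} \<in> spanning_trees G"
  obtain e where e: "e \<in> edges G" using assms(3) by blast
  then have "card (ends G e) = 2" "ends G e \<subseteq> verts G"
    using fin \<open>loopless G\<close> unfolding finite_multigraph_def loopless_def by auto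
  then obtain u v where uv: "u \<in> verts G" "v \<in> verts G" "u \<noteq> v" by (auto simp: card_2_iff)
  then have "linked (ends G) {} u v"
    using \<open>{} \<in> spanning_trees G\<close> unfolding spanning_trees_iff[OF fin] by blast
  then show False using \<open>u \<noteq> v\<close> by (induction rule: linked_induct) auto
qed

theorem opt_density_characterization:
  assumes fin: "finite_multigraph G" and con: "graph_connected G" and "loopless G" "edges G \<noteq> {}"
  shows "opt_density G \<in> tree_hull G"
    and "\<And>x. x \<in> tree_hull G \<Longrightarrow> opt_density G \<bullet> opt_density G \<le> opt_density G \<bullet> x"
proof -
  let ?p = "closest_point (tree_hull G) 0"
  have ne: "tree_hull G \<noteq> {}" using spanning_tree_exists[OF fin con] by simp
  have cl: "closed (tree_hull G)"
    using finite_spanning_trees[OF fin]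
    by (intro compact_imp_closed finite_imp_compact_convex_hull finite_imageI)
  have p: "?p \<in> tree_hull G" using cl ne by (rule closest_point_in_set)
  have var: "?p \<bullet> ?p \<le> ?p \<bullet> x" if "x \<in> tree_hull G" for x
    using closest_point_dot[OF convex_convex_hull cl that, of 0] by (simp add: inner_diff_right)
  have "opt_density G = ?p"
    using empty_not_spanning_tree[OF fin assms(3,4)] p var
    by (rule opt_density_eqI) (auto intro: hull_inc)
  then show "opt_density G \<in> tree_hull G"
    "\<And>x. x \<in> tree_hull G \<Longrightarrow> opt_density G \<bullet> opt_density G \<le> opt_density G \<bullet> x"
    using p var by auto
qed

section \<open>Optimal pmfs and fair trees\<close>

text \<open>The entry of this vector at \<open>e\<close> is the probability that a random tree contains \<open>e\<close>.\<close>

definition edge_usage :: "('v, 'e::finite) multigraph \<Rightarrow> 'e set pmf \<Rightarrow> real ^ 'e" where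
  "edge_usage G \<mu> = (\<Sum>\<gamma>\<in>spanning_trees G. pmf \<mu> \<gamma> *\<^sub>R tree_vector \<gamma>)"

lemma sum_pmf_trees:
  "finite_multigraph G \<Longrightarrow> \<mu> \<in> tree_pmfs G \<Longrightarrow> (\<Sum>\<gamma>\<in>spanning_trees G. pmf \<mu> \<gamma>) = 1"
  unfolding tree_pmfs_def by (simp add: sum_pmf_eq_1 finite_spanning_trees)

lemma edge_usage_in_tree_hull:
  assumes "finite_multigraph G" "\<mu> \<in> tree_pmfs G"
  shows "edge_usage G \<mu> \<in> tree_hull G"
  unfolding edge_usage_def
  using assms by (intro convex_sum) (auto simp: finite_spanning_trees sum_pmf_trees intro: hull_inc)

lemma tree_hull_imp_edge_usage:
  assumes fin: "finite_multigraph G" and x: "x \<in> tree_hull G"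
  obtains \<mu> where "\<mu> \<in> tree_pmfs G" "edge_usage G \<mu> = x"
proof -
  let ?S = "spanning_trees G"
  have finS: "finite ?S" using fin by (rule finite_spanning_trees)
  have inj: "inj_on tree_vector ?S"
    by (rule inj_onI) (metis (no_types, opaque_lifting) subsetI subset_antisym tree_vector_nth zero_neq_one)
  obtain w where w: "\<And>y. y \<in> tree_vector ` ?S \<Longrightarrow> 0 \<le> w y" "sum w (tree_vector ` ?S) = 1"
      "(\<Sum>y\<in>tree_vector ` ?S. w y *\<^sub>R y) = x"
    using x finS by (auto simp: convex_hull_finite)
  define m where "m \<gamma> = (if \<gamma> \<in> ?S then w (tree_vector \<gamma>) else 0)" for \<gamma>
  have m0: "\<And>\<gamma>. 0 \<le> m \<gamma>" using w(1) by (auto simp: m_def)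
  have "(\<Sum>\<gamma>\<in>?S. m \<gamma>) = 1" using w(2) by (simp add: sum.reindex[OF inj] m_def)
  moreover have "(\<integral>\<^sup>+ \<gamma>. ennreal (m \<gamma>) \<partial>count_space UNIV) = (\<Sum>\<gamma>\<in>?S. ennreal (m \<gamma>))"
    using finS by (intro nn_integral_count_space') (auto simp: m_def)
  ultimately have "(\<integral>\<^sup>+ \<gamma>. ennreal (m \<gamma>) \<partial>count_space UNIV) = 1" using m0 by simp
  then have pmf: "pmf (embed_pmf m) \<gamma> = m \<gamma>" for \<gamma> using m0 by (intro pmf_embed_pmf) auto
  show thesis
  proof
    show "embed_pmf m \<in> tree_pmfs G"
      unfolding tree_pmfs_def by (auto simp: set_pmf_iff pmf m_def split: if_splits)
    show "edge_usage G (embed_pmf m) = x"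
      using w(3) unfolding edge_usage_def by (simp add: sum.reindex[OF inj] pmf m_def)
  qed
qed

lemma expected_overlap_eq: "expected_overlap G \<mu> = edge_usage G \<mu> \<bullet> edge_usage G \<mu>"
  unfolding expected_overlap_def edge_usage_def
  by (simp add: inner_sum_left inner_sum_right tree_vector_inner ac_simps sum_distrib_left)

text \<open>Expected overlap is a squared norm, and edge usages fill the tree hull, so both optimization
  problems ask for the same point.\<close>

lemma meo_optimal_iff:
  fixes G :: "('v, 'e::finite) multigraph"
  assumes G: "finite_multigraph G" "graph_connected G" "loopless G" "edges G \<noteq> {}"
  shows "meo_optimal G \<mu> \<longleftrightarrow> \<mu> \<in> tree_pmfs G \<and> edge_usage G \<mu> = opt_density G"
proof -
  let ?p = "opt_density G"
  note p = opt_density_characterization[OF G]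
  have gap: "?p \<bullet> ?p + (x - ?p) \<bullet> (x - ?p) \<le> x \<bullet> x" if "x \<in> tree_hull G" for x
    using p(2)[OF that] by (simp add: inner_diff inner_commute)
  show ?thesis
  proof
    assume opt: "meo_optimal G \<mu>"
    then have \<mu>: "\<mu> \<in> tree_pmfs G" unfolding meo_optimal_def is_arg_min_def by simp
    obtain \<nu> where "\<nu> \<in> tree_pmfs G" "edge_usage G \<nu> = ?p"
      using tree_hull_imp_edge_usage[OF G(1) p(1)] .
    then have "edge_usage G \<mu> \<bullet> edge_usage G \<mu> \<le> ?p \<bullet> ?p"
      using opt unfolding meo_optimal_def is_arg_min_def expected_overlap_eq by (metis not_less)
    then have "(edge_usage G \<mu> - ?p) \<bullet> (edge_usage G \<mu> - ?p) \<le> 0"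
      using gap[OF edge_usage_in_tree_hull[OF G(1) \<mu>]] by linarith
    then show "\<mu> \<in> tree_pmfs G \<and> edge_usage G \<mu> = ?p" using \<mu> by (metis inner_gt_zero_iff not_less right_minus_eq)
  next
    assume \<mu>: "\<mu> \<in> tree_pmfs G \<and> edge_usage G \<mu> = ?p"
    have "?p \<bullet> ?p \<le> edge_usage G \<nu> \<bullet> edge_usage G \<nu>" if "\<nu> \<in> tree_pmfs G" for \<nu>
      using gap[OF edge_usage_in_tree_hull[OF G(1) that]]
        inner_ge_zero[of "edge_usage G \<nu> - ?p"] by linarith
    then show "meo_optimal G \<mu>"
      using \<mu> unfolding meo_optimal_def is_arg_min_def expected_overlap_eq by (auto simp: not_less)
  qed
qed

text \<open>The average weight of a random tree under an optimal pmf is the least possible weight, so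
  every tree in its support attains it.\<close>

lemma fair_tree_minimum_weight:
  fixes G :: "('v, 'e::finite) multigraph"
  assumes G: "finite_multigraph G" "graph_connected G" "loopless G" "edges G \<noteq> {}"
    and fair: "fair_tree G \<gamma>" and \<gamma>': "\<gamma>' \<in> spanning_trees G"
  shows "(\<Sum>e\<in>\<gamma>. opt_density G $ e) \<le> (\<Sum>e\<in>\<gamma>'. opt_density G $ e)"
proof -
  let ?p = "opt_density G" and ?S = "spanning_trees G"
  have low: "?p \<bullet> ?p \<le> ?p \<bullet> tree_vector \<tau>" if "\<tau> \<in> ?S" for \<tau>
    using opt_density_characterization(2)[OF G] that by (simp add: hull_inc)
  obtain \<mu> where \<gamma>: "\<gamma> \<in> ?S" and \<mu>: "meo_optimal G \<mu>" "0 < pmf \<mu> \<gamma>"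
    using fair unfolding fair_tree_def by blast
  then have \<mu>': "\<mu> \<in> tree_pmfs G" "edge_usage G \<mu> = ?p" using meo_optimal_iff[OF G] by auto
  have "(\<Sum>\<tau>\<in>?S. pmf \<mu> \<tau> * (?p \<bullet> tree_vector \<tau> - ?p \<bullet> ?p))
      = ?p \<bullet> edge_usage G \<mu> - (\<Sum>\<tau>\<in>?S. pmf \<mu> \<tau>) * (?p \<bullet> ?p)"
    unfolding edge_usage_def
    by (simp add: inner_sum_right algebra_simps sum_subtractf sum_distrib_right)
  also have "\<dots> = 0" using \<mu>' sum_pmf_trees[OF G(1) \<mu>'(1)] by simp
  finally have "\<forall>\<tau>\<in>?S. pmf \<mu> \<tau> * (?p \<bullet> tree_vector \<tau> - ?p \<bullet> ?p) = 0"
    using low by (subst (asm) sum_nonneg_eq_0_iff) (auto simp: finite_spanning_trees[OF G(1)])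
  then have "?p \<bullet> tree_vector \<gamma> = ?p \<bullet> ?p" using \<gamma> \<mu>(2) by force
  then show ?thesis using low[OF \<gamma>'] by (simp add: inner_tree_vector)
qed

section \<open>Components of minimal density\<close>

text \<open>If the part of \<open>\<gamma>\<close> inside \<open>F\<close> failed to link the ends of \<open>e\<close>, then \<open>e\<close> could replace
  an edge of \<open>\<gamma>\<close> outside \<open>F\<close>, and the tree would become lighter.\<close>

lemma minimum_weight_tree_links_light_edges:
  fixes G :: "('v, 'e::finite) multigraph" and w :: "'e \<Rightarrow> real"
  assumes fin: "finite_multigraph G" and \<gamma>: "\<gamma> \<in> spanning_trees G"
    and min: "\<And>\<gamma>'. \<gamma>' \<in> spanning_trees G \<Longrightarrow> sum w \<gamma> \<le> sum w \<gamma>'"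
    and light: "\<And>f. f \<in> edges G - F \<Longrightarrow> w e < w f"
    and e: "e \<in> edges G \<inter> F" "ends G e = {u, v}"
  shows "linked (ends G) (\<gamma> \<inter> F) u v"
proof (rule ccontr)
  assume no: "\<not> linked (ends G) (\<gamma> \<inter> F) u v"
  then have "e \<notin> \<gamma>" using e linked_edge[of e "\<gamma> \<inter> F" "ends G" u v] by blast
  have "e \<in> edges G" using e by simp
  then obtain f where f: "f \<in> \<gamma> - F" "insert e (\<gamma> - {f}) \<in> spanning_trees G"
    using spanning_tree_exchange[OF fin \<gamma> _ e(2) no] by blast
  have "sum w \<gamma> = w f + sum w (\<gamma> - {f})" using f by (intro sum.remove) auto
  moreover have "sum w (insert e (\<gamma> - {f})) = w e + sum w (\<gamma> - {f})"
    using \<open>e \<notin> \<gamma>\<close> by (intro sum.insert) auto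
  moreover have "w e < w f" using f \<gamma> by (intro light) (auto simp: spanning_trees_def)
  ultimately show False using min[OF f(2)] by simp
qed

text \<open>Because all spanning trees have the same number of edges, a constant vector has the same
  inner product with all of them, and the variational inequality holds with equality.\<close>

lemma homogeneousI:
  fixes H :: "('v, 'e::finite) multigraph"
  assumes H: "finite_multigraph H" "loopless H" "edges H \<noteq> {}"
    and q: "q \<in> tree_hull H" and const: "\<And>e. e \<in> edges H \<Longrightarrow> q $ e = c"
  shows "homogeneous H"
proof -
  have weight: "q \<bullet> tree_vector \<tau> = c * card \<tau>" if "\<tau> \<in> spanning_trees H" for \<tau>
  proof -
    have "(\<Sum>e\<in>\<tau>. q $ e) = (\<Sum>e\<in>\<tau>. c)"
      using that const by (intro sum.cong) (auto simp: spanning_trees_def)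
    then show ?thesis by (simp add: inner_tree_vector)
  qed
  have "q \<bullet> q \<le> q \<bullet> tree_vector \<tau>" if \<tau>: "\<tau> \<in> spanning_trees H" for \<tau>
  proof -
    have "tree_hull H \<subseteq> {x. q \<bullet> x \<le> c * card \<tau>}"
      using weight spanning_trees_same_card[OF H(1) _ \<tau>]
      by (intro hull_minimal convex_halfspace_le) auto
    then show ?thesis using q weight[OF \<tau>] by auto
  qed
  then have "opt_density H = q"
    using empty_not_spanning_tree[OF H] q by (intro opt_density_eqI)
  then show ?thesis using const unfolding homogeneous_def by blast
qed

theorem theorem5p2:
  fixes G H :: "('v, 'e::finite) multigraph"
  assumes "finite_multigraph G"
    and "graph_connected G"
    and "loopless G"
    and "edges G \<noteq> {}"
    and "H \<in> graph_components (H_min G)"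
  shows "edges H \<noteq> {} \<and>
         restriction_property G H \<and>
         vertex_induced G H \<and>
         homogeneous H"
proof -
  note G = assms(1-4)
  let ?p = "opt_density G" and ?L = "linked (ends G)"
  define F where "F = {e \<in> edges G. \<forall>e'\<in>edges G. ?p $ e \<le> ?p $ e'}"
  have FG: "F \<subseteq> edges G" unfolding F_def by blast
  have Hmin: "H_min G = G\<lparr>verts := (\<Union>e\<in>F. ends G e), edges := F\<rparr>"
    unfolding H_min_def edge_induced_def F_def ..
  obtain a where aF: "a \<in> (\<Union>e\<in>F. ends G e)"
    and H_eq: "H = G\<lparr>verts := {w \<in> (\<Union>e\<in>F. ends G e). ?L F a w},
      edges := {e \<in> F. ends G e \<subseteq> {w \<in> (\<Union>e\<in>F. ends G e). ?L F a w}}\<rparr>"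
    using assms(5) unfolding graph_components_def Hmin reachable_eq_linked by auto
  define C where "C = verts H"
  have C: "C = {w \<in> (\<Union>e\<in>F. ends G e). ?L F a w}" using H_eq by (simp add: C_def)
  have EH: "edges H = {e \<in> F. ends G e \<subseteq> C}" using H_eq by (simp add: C)
  have endsH: "ends H = ends G" using H_eq by simp
  have vH: "verts H = C" by (simp add: C_def)
  have aC: "a \<in> C" using aF by (simp add: C linked_refl)
  have endsG: "ends G e \<subseteq> verts G" "card (ends G e) = 2" if "e \<in> edges G" for e
    using that G(1,3) unfolding finite_multigraph_def loopless_def by auto
  have pair: "\<exists>u v. ends G e = {u, v}" if "e \<in> edges G" for e
    using endsG(2)[OF that] by (auto simp: card_2_iff)
  have closed: "y \<in> C" if "e \<in> F" "ends G e = {x, y}" "x \<in> C" for e x y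
  proof -
    have "?L F x y" using that by (intro linked_edge[of e])
    then have "?L F a y" using that(3) linked_trans by (auto simp: C)
    moreover have "y \<in> (\<Union>e\<in>F. ends G e)" using that by blast
    ultimately show ?thesis by (simp add: C)
  qed
  have touch: "e \<in> edges H" if e: "e \<in> F" and x: "x \<in> ends G e" "x \<in> C" for e x
  proof -
    obtain u v where uv: "ends G e = {u, v}" using pair e FG by blast
    then have "u \<in> C" "v \<in> C" using x closed[OF e, of u v] closed[OF e, of v u] by auto
    then show ?thesis using e uv by (simp add: EH)
  qed
  have CG: "C \<subseteq> verts G" using endsG(1) FG by (auto simp: C)
  have EHF: "edges H \<subseteq> F" by (auto simp: EH)
  have sub: "is_subgraph H G" using CG EHF FG unfolding is_subgraph_def vH endsH by blast

  have edgesH: "edges H \<noteq> {}"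
  proof -
    obtain e where "e \<in> F" "a \<in> ends G e" using aF by blast
    then show ?thesis using touch aC by blast
  qed
  have finH: "finite_multigraph H"
    using G(1) CG endsG EHF FG unfolding finite_multigraph_def vH endsH
    by (auto simp: EH intro: finite_subset)
  have loopH: "loopless H" using G(3) EHF FG unfolding loopless_def endsH by blast
  have inside: "?L (S \<inter> edges H) x y" if "?L (S \<inter> F) x y" "x \<in> C" for S x y
  proof -
    have "?L {e \<in> S \<inter> F. ends G e \<subseteq> C} x y"
      using linked_within_closed[OF that] closed by blast
    moreover have "{e \<in> S \<inter> F. ends G e \<subseteq> C} = S \<inter> edges H" by (auto simp: EH)
    ultimately show ?thesis by simp
  qed
  have connH: "?L (edges H) x y" if "x \<in> C" "y \<in> C" for x y
  proof -
    have "?L (UNIV \<inter> F) x y" using that linked_sym linked_trans by (fastforce simp: C)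
    from inside[OF this that(1)] show ?thesis by simp
  qed

  have restrict: "\<gamma> \<inter> edges H \<in> spanning_trees H" if fair: "fair_tree G \<gamma>" for \<gamma>
  proof -
    have \<gamma>: "\<gamma> \<in> spanning_trees G" using fair unfolding fair_tree_def by blast
    have edge: "?L (\<gamma> \<inter> edges H) x y" if e: "e \<in> edges H" "ends G e = {x, y}" for e x y
    proof -
      \<comment> \<open>Edges outside \<open>F\<close>, but not those of the other components of \<open>F\<close>, are heavier than \<open>e\<close>;
        for this reason the exchange is made with \<open>F\<close> and only then localized to \<open>H\<close>.\<close>
      have "?p $ e < ?p $ f" if f: "f \<in> edges G - F" for f
      proof -
        obtain g where "g \<in> edges G" "?p $ g < ?p $ f" using f unfolding F_def by force
        moreover have "?p $ e \<le> ?p $ g"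
          using e EHF \<open>g \<in> edges G\<close> unfolding F_def by blast
        ultimately show ?thesis by simp
      qed
      moreover have "e \<in> edges G \<inter> F" using e EHF FG by blast
      ultimately have "?L (\<gamma> \<inter> F) x y"
        using minimum_weight_tree_links_light_edges[OF G(1) \<gamma> fair_tree_minimum_weight[OF G fair]] e
        by blast
      moreover have "x \<in> C" using e by (simp add: EH)
      ultimately show ?thesis by (rule inside)
    qed
    have "?L (\<gamma> \<inter> edges H) x y" if "x \<in> C" "y \<in> C" for x y
      using connH[OF that] edge by (rule linked_substitute)
    moreover have "\<not> ?L (\<gamma> \<inter> edges H - {e}) x y" if e: "e \<in> \<gamma> \<inter> edges H" "ends G e = {x, y}" for e x y
    proof
      assume "?L (\<gamma> \<inter> edges H - {e}) x y"
      then have "?L (\<gamma> - {e}) x y" by (rule linked_mono) blast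
      then show False using \<gamma> e unfolding spanning_trees_iff[OF G(1)] by blast
    qed
    ultimately show ?thesis
      unfolding spanning_trees_iff[OF finH] vH endsH using aC by blast
  qed

  obtain \<mu> where \<mu>: "\<mu> \<in> tree_pmfs G" "edge_usage G \<mu> = ?p"
    using tree_hull_imp_edge_usage[OF G(1) opt_density_characterization(1)[OF G]] .
  then have opt: "meo_optimal G \<mu>" using meo_optimal_iff[OF G] by blast
  have fair: "fair_tree G \<gamma>" if "\<gamma> \<in> spanning_trees G" "pmf \<mu> \<gamma> \<noteq> 0" for \<gamma>
    using that opt unfolding fair_tree_def by (metis pmf_pos)
  have p_nth: "?p $ e = (\<Sum>\<gamma>\<in>spanning_trees G. pmf \<mu> \<gamma> * (if e \<in> \<gamma> then 1 else 0))" for e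
    unfolding \<mu>(2)[symmetric] edge_usage_def by (simp add: tree_vector_nth)

  \<comment> \<open>An edge outside \<open>F\<close> has positive density and so lies in some fair tree. With both ends in \<open>H\<close> it
    would close a cycle with the part of that tree inside \<open>H\<close>.\<close>
  have induced: "e \<in> edges H" if e: "e \<in> edges G" "ends G e \<subseteq> C" for e
  proof (rule ccontr)
    assume eH: "e \<notin> edges H"
    obtain u v where uv: "ends G e = {u, v}" using pair e by blast
    have "e \<notin> F" using eH e by (simp add: EH)
    then obtain g where "g \<in> edges G" "?p $ g < ?p $ e" using e unfolding F_def by force
    moreover have "0 \<le> ?p $ g" unfolding p_nth by (intro sum_nonneg) auto
    ultimately have "?p $ e \<noteq> 0" by simp
    then obtain \<gamma> where "\<gamma> \<in> spanning_trees G" "pmf \<mu> \<gamma> * (if e \<in> \<gamma> then 1 else 0) \<noteq> 0"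
      unfolding p_nth by (metis (no_types, lifting) sum.neutral)
    then have \<gamma>: "\<gamma> \<in> spanning_trees G" "e \<in> \<gamma>" "fair_tree G \<gamma>"
      using fair by (auto split: if_splits)
    have "?L (\<gamma> \<inter> edges H) u v"
      using restrict[OF \<gamma>(3)] e uv unfolding spanning_trees_iff[OF finH] vH endsH by blast
    then have "?L (\<gamma> - {e}) u v" by (rule linked_mono) (use eH in blast)
    then show False using \<gamma>(1,2) uv unfolding spanning_trees_iff[OF G(1)] by blast
  qed

  obtain e\<^sub>0 where e\<^sub>0: "e\<^sub>0 \<in> edges H" using edgesH by blast
  \<comment> \<open>Intersecting the random tree of \<open>G\<close> with \<open>H\<close> gives a random spanning tree of \<open>H\<close>, whose edge
    usage is the restriction of \<open>?p\<close> to \<open>H\<close>. Trees of probability zero are discarded because they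
    need not be fair and may fail to restrict.\<close>
  have homog: "homogeneous H"
  proof (rule homogeneousI[OF finH loopH edgesH])
    show "(\<Sum>\<gamma>\<in>{\<gamma> \<in> spanning_trees G. pmf \<mu> \<gamma> \<noteq> 0}. pmf \<mu> \<gamma> *\<^sub>R tree_vector (\<gamma> \<inter> edges H)) \<in> tree_hull H"
      (is "?q \<in> _")
    proof (rule convex_sum)
      have "(\<Sum>\<gamma>\<in>{\<gamma> \<in> spanning_trees G. pmf \<mu> \<gamma> \<noteq> 0}. pmf \<mu> \<gamma>) = (\<Sum>\<gamma>\<in>spanning_trees G. pmf \<mu> \<gamma>)"
        using finite_spanning_trees[OF G(1)] by (intro sum.mono_neutral_left) auto
      then show "(\<Sum>\<gamma>\<in>{\<gamma> \<in> spanning_trees G. pmf \<mu> \<gamma> \<noteq> 0}. pmf \<mu> \<gamma>) = 1"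
        using sum_pmf_trees[OF G(1) \<mu>(1)] by simp
      fix \<gamma> assume "\<gamma> \<in> {\<gamma> \<in> spanning_trees G. pmf \<mu> \<gamma> \<noteq> 0}"
      then have "\<gamma> \<inter> edges H \<in> spanning_trees H" using fair restrict by blast
      then show "tree_vector (\<gamma> \<inter> edges H) \<in> tree_hull H" by (intro hull_inc imageI)
    qed (auto simp: finite_spanning_trees[OF G(1)])
    fix e assume e: "e \<in> edges H"
    have "?q $ e = (\<Sum>\<gamma>\<in>{\<gamma> \<in> spanning_trees G. pmf \<mu> \<gamma> \<noteq> 0}. pmf \<mu> \<gamma> * (if e \<in> \<gamma> then 1 else 0))"
      using e by (simp add: tree_vector_nth)
    also have "\<dots> = ?p $ e"
      unfolding p_nth using finite_spanning_trees[OF G(1)] by (intro sum.mono_neutral_left) auto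
    also have "\<dots> = ?p $ e\<^sub>0"
      using e e\<^sub>0 EHF FG unfolding F_def by (auto intro!: antisym)
    finally show "?q $ e = ?p $ e\<^sub>0" .
  qed

  show ?thesis
    using edgesH sub restrict induced homog
    unfolding restriction_property_def vertex_induced_def vH by blast
qed

end
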